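(* Consider the resampled risk model described in the context, in which each $X_i(\cdot)$ is the sum of a (drifted) Brownian motion and a compound Poisson process (with jumps of either sign allowed), under the standing assumptions listed there. Let $\pi(u)=\mathbb{P}(\exists t\ge0:X(t)\ge u)$, and let $L=L(u)$ be the random output of the importance-sampling algorithm described in the context, run with level $u$. If $\pi(u)\,e^{\omega^\star u}\to A$ as $u\to\infty$ for some $A>0$, then the algorithm, as an estimation procedure for $\pi(u)$, has bounded relative error, i.e. $$\limsup_{u\to\infty}\frac{\mathrm{Var}_{\mathbb Q}(L(u))}{\pi(u)^2}<\infty ,$$ where $\mathrm{Var}_{\mathbb Q}$ denotes the variance under the sampling distribution of the algorithm.
   Context: Model. Let $d\in\mathbb{N}$, $q>0$, and $p_1,\dots,p_d\in[0,1]$ with $\sum_i p_i=1$. For $i=1,\dots,d$ let $X_i(\cdot)$ be a Lévy process with $X_i(0)=0$, the sum of a Brownian motion with drift and an independent compound Poisson process, with Laplace exponent $$\varphi_i(\alpha)=\log\mathbb{E}\,e^{-\alpha X_i(1)}=r_i\alpha+\tfrac12\sigma_i^2\alpha^2-\lambda_i+\lambda_ib_i(\alpha),$$ where $r_i\in\mathbb{R}$, $\sigma_i^2>0$, $\lambda_i>0$ is the claim arrival rate, and $b_i(\alpha)=\mathbb{E}\,e^{-\alpha B}$ is the transform of the claim size in state $i$ (a real random variable; negative claims are allowed). Let $0=T_0<T_1<T_2<\dots$, where $T_1,T_2,\dots$ are the jump epochs of a Poisson process of rate $q$. Let $J_0,J_1,\dots$ be i.i.d. on $\{1,\dots,d\}$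 with $\mathbb{P}(J_n=i)=p_i$; the Lévy processes, the Poisson process and $(J_n)$ are independent. Define $X(0)=0$ and recursively $X(t)=X(T_n)+\big(X_{J_n}(t)-X_{J_n}(T_n)\big)$ for $t\in[T_n,T_{n+1})$, where the increment over the interval is also added at its right endpoint to give $X(T_{n+1})$. Let $Y$ be distributed as $X(T_1)$. Standing assumptions. (1) Negative drift: $\sum_{i=1}^d p_i\varphi_i'(0)>0$. (2) Light tails: each $\varphi_i$ is finite in an open neighbourhood of $0$. (3) There is a (unique) $\omega^\star>0$ with $\mathbb{E}\,e^{\omega^\star Y}=1$, i.e. $\sum_{i=1}^d p_i\,\frac{q}{q-\varphi_i(-\omega^\star)}=1$, where $\varphi_i(-\omega^\star)$ is finite and $\varphi_i(-\omega^\star)<q$ for all $i$. Parameters under the new measure $\mathbb{Q}$. Put $$p_i^{\mathbb Q}=p_i\frac{q}{q-\varphi_i(-\omega^\star)},\quad q_i=q,\quad q_i^{\mathbb Q}=q-\varphi_i(-\omega^\star),\quad r_i^{\mathbb Q}=r_i-\omega^\star\sigma_i^2,\quad \lambda_i^{\mathbb Q}=\lambda_ib_i(-\omega^\star),\quad b_i^{\mathbb Q}(\alpha)=\frac{b_i(\alpha-\omega^\star)}{b_i(-\omega^\star)},$$ $$f_i=\lambda_i+q,\quad f_i^{\mathbb Q}=\lambda_i^{\mathbb Q}+q_i^{\mathbb Q},\quad \alpha_{i,\pm}=\frac{\sqrt{r_i^2+2f_i\sigma_i^2}\pm r_i}{\sigma_i^2},\quad \alpha^{\mathbb Q}_{i,\pm}=\frac{\sqrt{(r^{\mathbb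 Q}_i)^2+2f^{\mathbb Q}_i\sigma_i^2}\pm r^{\mathbb Q}_i}{\sigma_i^2}.$$ Algorithm (all draws independent). Initialise $X:=0$, $L:=1$. Repeat the following cycle until exit: (a) Draw $I$ from $(p_1^{\mathbb Q},\dots,p_d^{\mathbb Q})$ and set $L:=L\cdot p_I/p_I^{\mathbb Q}$. (b) Draw a new uniform random number on $[0,1]$. While the newly drawn number is smaller than $\lambda_I^{\mathbb Q}/f_I^{\mathbb Q}$, perform (b1)–(b4) and then draw a new uniform number and test again: (b1) $L:=L\cdot(f_I^{\mathbb Q}/f_I)\cdot(\lambda_I/\lambda_I^{\mathbb Q})$. (b2) Draw $\mathbb{A}^+$ exponential with parameter $\alpha_{I,+}^{\mathbb Q}$; set $X:=X+\mathbb{A}^+$ and $L:=L\cdot(\alpha_{I,+}/\alpha_{I,+}^{\mathbb Q})\exp(-(\alpha_{I,+}-\alpha_{I,+}^{\mathbb Q})\mathbb{A}^+)$. If $X>u$, return $L$ and exit. (b3) Draw $\mathbb{A}^-$ exponential with parameter $\alpha_{I,-}^{\mathbb Q}$; set $X:=X-\mathbb{A}^-$ and $L:=L\cdot(\alpha_{I,-}/\alpha_{I,-}^{\mathbb Q})\exp(-(\alpha_{I,-}-\alpha_{I,-}^{\mathbb Q})\mathbb{A}^-)$. (b4) Draw $\mathbb{B}$ from the distribution with transform $b_I^{\mathbb Q}(\cdot)$; set $X:=X+\mathbb{B}$ and $L:=L\cdot e^{-\omega^\star\mathbb{B}}\,b_I(-\omega^\star)$. If $X>u$, return $L$ and exit.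 (c) When the while-loop ends, set $L:=L\cdot(f_I^{\mathbb Q}/f_I)\cdot(q_I/q_I^{\mathbb Q})$. Draw $\mathbb{A}^+$ and update $X$ and $L$ as in (b2); if $X>u$, return $L$ and exit. Otherwise draw $\mathbb{A}^-$ and update $X$ and $L$ as in (b3), and start a new cycle at (a). *)

theory Defs
  imports "HOL-Probability.Probability"
begin

section \<open>Processes\<close>

definition process_sets ::
    "'w measure \<Rightarrow> 't set \<Rightarrow> 'b measure \<Rightarrow> ('t \<Rightarrow> 'w \<Rightarrow> 'b) \<Rightarrow> 'w set set" where
  "process_sets M I N Z =
     sigma_sets (space M) {Z t -` A \<inter> space M | t A. t \<in> I \<and> A \<in> sets N}"

definition brownian_motion :: "'w measure \<Rightarrow> (real \<Rightarrow> 'w \<Rightarrow> real) \<Rightarrow> bool" where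
  "brownian_motion M W \<longleftrightarrow>
     (\<forall>w\<in>space M. W 0 w = 0 \<and> continuous_on {0..} (\<lambda>t. W t w)) \<and>
     (\<forall>s t. 0 \<le> s \<and> s < t \<longrightarrow>
        distributed M lborel (\<lambda>w. W t w - W s w) (normal_density 0 (sqrt (t - s)))) \<and>
     (\<forall>ts :: nat \<Rightarrow> real. mono ts \<and> 0 \<le> ts 0 \<longrightarrow>
        prob_space.indep_vars M (\<lambda>_. borel) (\<lambda>k w. W (ts (Suc k)) w - W (ts k) w) UNIV)"

text \<open>A Poisson process of rate \<open>c\<close>, given by its epochs \<open>0 = T 0 < T 1 < T 2 < \<dots>\<close>.\<close>

definition poisson_epochs :: "'w measure \<Rightarrow> real \<Rightarrow> (nat \<Rightarrow> 'w \<Rightarrow> real) \<Rightarrow> bool" where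
  "poisson_epochs M c T \<longleftrightarrow>
     (\<forall>w\<in>space M. T 0 w = 0 \<and> strict_mono (\<lambda>n. T n w)) \<and>
     (\<forall>n. distributed M lborel (\<lambda>w. T (Suc n) w - T n w) (exponential_density c)) \<and>
     prob_space.indep_vars M (\<lambda>_. borel) (\<lambda>n w. T (Suc n) w - T n w) UNIV"

definition epoch_count :: "(nat \<Rightarrow> 'w \<Rightarrow> real) \<Rightarrow> real \<Rightarrow> 'w \<Rightarrow> nat" where
  "epoch_count T t w = card {n. 1 \<le> n \<and> T n w \<le> t}"

definition compound_poisson ::
    "'w measure \<Rightarrow> real \<Rightarrow> real measure \<Rightarrow> (real \<Rightarrow> 'w \<Rightarrow> real) \<Rightarrow> bool" where
  "compound_poisson M c F Z \<longleftrightarrow>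
     (\<exists>S C. poisson_epochs M c S \<and>
        prob_space.indep_vars M (\<lambda>_. borel) C (UNIV :: nat set) \<and>
        (\<forall>k. distr M borel (C k) = F) \<and>
        prob_space.indep_set M (process_sets M UNIV borel S) (process_sets M UNIV borel C) \<and>
        (\<forall>t\<ge>0. \<forall>w\<in>space M. Z t w = (\<Sum>k<epoch_count S t w. C k w)))"

text \<open>The drift term is \<open>- r\<close>: the Laplace exponent is taken at \<open>- \<alpha>\<close>, so that its linear term
  is \<open>r \<alpha>\<close>, and claims push the process upwards; see \<open>claims_levy_laplace\<close>.\<close>

definition claims_levy ::
    "'w measure \<Rightarrow> real \<Rightarrow> real \<Rightarrow> real \<Rightarrow> real measure \<Rightarrow> (real \<Rightarrow> 'w \<Rightarrow> real) \<Rightarrow> bool" where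
  "claims_levy M r \<sigma> c F X \<longleftrightarrow>
     (\<exists>W Z. brownian_motion M W \<and> compound_poisson M c F Z \<and>
        prob_space.indep_set M (process_sets M {0..} borel W) (process_sets M {0..} borel Z) \<and>
        (\<forall>t\<ge>0. \<forall>w\<in>space M. X t w = - r * t + \<sigma> * W t w + Z t w))"

definition laplace_transform :: "'w measure \<Rightarrow> ('w \<Rightarrow> real) \<Rightarrow> real \<Rightarrow> ennreal" where
  "laplace_transform M Z \<alpha> = (\<integral>\<^sup>+ w. ennreal (exp (- \<alpha> * Z w)) \<partial>M)"

section \<open>The resampled model\<close>

primrec resampled_at_epoch ::
    "('i \<Rightarrow> real \<Rightarrow> 'w \<Rightarrow> real) \<Rightarrow> (nat \<Rightarrow> 'w \<Rightarrow> real) \<Rightarrow> (nat \<Rightarrow> 'w \<Rightarrow> 'i) \<Rightarrow> nat \<Rightarrow> 'w \<Rightarrow> real"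
  where
  "resampled_at_epoch X T J 0 w = 0"
| "resampled_at_epoch X T J (Suc n) w =
     resampled_at_epoch X T J n w + (X (J n w) (T (Suc n) w) w - X (J n w) (T n w) w)"

text \<open>For \<open>t \<in> [T n, T (n + 1))\<close> the epoch count is \<open>n\<close>.\<close>

definition resampled ::
    "('i \<Rightarrow> real \<Rightarrow> 'w \<Rightarrow> real) \<Rightarrow> (nat \<Rightarrow> 'w \<Rightarrow> real) \<Rightarrow> (nat \<Rightarrow> 'w \<Rightarrow> 'i) \<Rightarrow> real \<Rightarrow> 'w \<Rightarrow> real"
  where
  "resampled X T J t w =
     (let n = epoch_count T t w
      in resampled_at_epoch X T J n w + (X (J n w) t w - X (J n w) (T n w) w))"

definition ruin_prob ::
    "'w measure \<Rightarrow> ('i \<Rightarrow> real \<Rightarrow> 'w \<Rightarrow> real) \<Rightarrow> (nat \<Rightarrow> 'w \<Rightarrow> real) \<Rightarrow> (nat \<Rightarrow> 'w \<Rightarrow> 'i) \<Rightarrow> real \<Rightarrow> real"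
  where
  "ruin_prob M X T J u = measure M {w \<in> space M. \<exists>t\<ge>0. resampled X T J t w \<ge> u}"

record 'i risk_params =
  qrate :: real                       \<comment> \<open>\<open>q\<close>\<close>
  wgt :: "'i \<Rightarrow> real"                  \<comment> \<open>\<open>p\<^sub>i\<close>\<close>
  prem :: "'i \<Rightarrow> real"                 \<comment> \<open>\<open>r\<^sub>i\<close>\<close>
  vol :: "'i \<Rightarrow> real"                  \<comment> \<open>\<open>\<sigma>\<^sub>i\<close>\<close>
  arr :: "'i \<Rightarrow> real"                  \<comment> \<open>\<open>\<lambda>\<^sub>i\<close>\<close>
  claim :: "'i \<Rightarrow> real measure"        \<comment> \<open>claim size distribution\<close>

definition claim_lt :: "'i risk_params \<Rightarrow> 'i \<Rightarrow> real \<Rightarrow> ennreal" where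
  "claim_lt P i \<alpha> = laplace_transform (claim P i) (\<lambda>x. x) \<alpha>"

abbreviation bfun :: "'i risk_params \<Rightarrow> 'i \<Rightarrow> real \<Rightarrow> real" where
  "bfun P i \<alpha> \<equiv> enn2real (claim_lt P i \<alpha>)"

text \<open>The Laplace exponent of the \<open>i\<close>-th process is finite at \<open>\<alpha>\<close> iff
  \<open>claim_lt P i \<alpha> < \<infinity>\<close>, and it then equals \<open>phi P i \<alpha>\<close>; see \<open>resampled_model_phi\<close>.\<close>

definition phi :: "'i risk_params \<Rightarrow> 'i \<Rightarrow> real \<Rightarrow> real" where
  "phi P i \<alpha> = prem P i * \<alpha> + (vol P i)\<^sup>2 * \<alpha>\<^sup>2 / 2 - arr P i + arr P i * bfun P i \<alpha>"

datatype 'i source = Levy 'i | Epochs | Regimes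

definition resampled_model ::
    "'w measure \<Rightarrow> ('i::finite) risk_params \<Rightarrow> ('i \<Rightarrow> real \<Rightarrow> 'w \<Rightarrow> real) \<Rightarrow>
     (nat \<Rightarrow> 'w \<Rightarrow> real) \<Rightarrow> (nat \<Rightarrow> 'w \<Rightarrow> 'i) \<Rightarrow> bool" where
  "resampled_model M P X T J \<longleftrightarrow>
     prob_space M \<and> qrate P > 0 \<and>
     (\<forall>i. 0 \<le> wgt P i \<and> wgt P i \<le> 1) \<and> (\<Sum>i\<in>UNIV. wgt P i) = 1 \<and>
     (\<forall>i. (vol P i)\<^sup>2 > 0 \<and> arr P i > 0 \<and> real_distribution (claim P i)) \<and>
     (\<forall>i. claims_levy M (prem P i) (vol P i) (arr P i) (claim P i) (X i)) \<and>
     poisson_epochs M (qrate P) T \<and>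
     prob_space.indep_vars M (\<lambda>_. count_space UNIV) J UNIV \<and>
     (\<forall>n i. measure M {w \<in> space M. J n w = i} = wgt P i) \<and>
     prob_space.indep_sets M
       (\<lambda>s. case s of
          Levy i \<Rightarrow> process_sets M {0..} borel (X i)
        | Epochs \<Rightarrow> process_sets M UNIV borel T
        | Regimes \<Rightarrow> process_sets M UNIV (count_space UNIV) J) UNIV"

section \<open>Parameters under the new measure\<close>

text \<open>Throughout, \<open>\<omega>\<close> is the root of \<open>E exp (\<omega> Y) = 1\<close>.\<close>

definition wgtQ :: "'i risk_params \<Rightarrow> real \<Rightarrow> 'i \<Rightarrow> real" where
  "wgtQ P \<omega> i = wgt P i * (qrate P / (qrate P - phi P i (- \<omega>)))"

definition qrateQ :: "'i risk_params \<Rightarrow> real \<Rightarrow> 'i \<Rightarrow> real" where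
  "qrateQ P \<omega> i = qrate P - phi P i (- \<omega>)"

definition premQ :: "'i risk_params \<Rightarrow> real \<Rightarrow> 'i \<Rightarrow> real" where
  "premQ P \<omega> i = prem P i - \<omega> * (vol P i)\<^sup>2"

definition arrQ :: "'i risk_params \<Rightarrow> real \<Rightarrow> 'i \<Rightarrow> real" where
  "arrQ P \<omega> i = arr P i * bfun P i (- \<omega>)"

definition claim_ltQ :: "'i risk_params \<Rightarrow> real \<Rightarrow> 'i \<Rightarrow> real \<Rightarrow> ennreal" where
  "claim_ltQ P \<omega> i \<alpha> = claim_lt P i (\<alpha> - \<omega>) / claim_lt P i (- \<omega>)"

definition totrate :: "'i risk_params \<Rightarrow> 'i \<Rightarrow> real" where
  "totrate P i = arr P i + qrate P"

definition totrateQ :: "'i risk_params \<Rightarrow> real \<Rightarrow> 'i \<Rightarrow> real" where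
  "totrateQ P \<omega> i = arrQ P \<omega> i + qrateQ P \<omega> i"

definition alpha_plus :: "'i risk_params \<Rightarrow> 'i \<Rightarrow> real" where
  "alpha_plus P i =
     (sqrt ((prem P i)\<^sup>2 + 2 * totrate P i * (vol P i)\<^sup>2) + prem P i) / (vol P i)\<^sup>2"

definition alpha_minus :: "'i risk_params \<Rightarrow> 'i \<Rightarrow> real" where
  "alpha_minus P i =
     (sqrt ((prem P i)\<^sup>2 + 2 * totrate P i * (vol P i)\<^sup>2) - prem P i) / (vol P i)\<^sup>2"

definition alpha_plusQ :: "'i risk_params \<Rightarrow> real \<Rightarrow> 'i \<Rightarrow> real" where
  "alpha_plusQ P \<omega> i =
     (sqrt ((premQ P \<omega> i)\<^sup>2 + 2 * totrateQ P \<omega> i * (vol P i)\<^sup>2) + premQ P \<omega> i) / (vol P i)\<^sup>2"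

definition alpha_minusQ :: "'i risk_params \<Rightarrow> real \<Rightarrow> 'i \<Rightarrow> real" where
  "alpha_minusQ P \<omega> i =
     (sqrt ((premQ P \<omega> i)\<^sup>2 + 2 * totrateQ P \<omega> i * (vol P i)\<^sup>2) - premQ P \<omega> i) / (vol P i)\<^sup>2"

section \<open>The algorithm\<close>

text \<open>One round consists of one test of the while-condition together with the steps that follow
  it: (b1)--(b4) if the test succeeds, (c) if it fails; a round entered in mode \<open>NewCycle\<close>
  first performs (a). Each round gets its own fresh independent draws: a candidate for \<open>I\<close>, the
  uniform number, and for each state \<open>i\<close> candidates for \<open>\<bbbA>\<^sup>+\<close>, \<open>\<bbbA>\<^sup>-\<close> and \<open>\<bbbB>\<close>, of which
  only those belonging to the current value of \<open>I\<close> are used.\<close>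

type_synonym 'i draws = "'i \<times> real \<times> ('i \<Rightarrow> real) \<times> ('i \<Rightarrow> real) \<times> ('i \<Rightarrow> real)"

definition round_measure ::
    "('i::finite) risk_params \<Rightarrow> real \<Rightarrow> ('i \<Rightarrow> real measure) \<Rightarrow> 'i draws measure" where
  "round_measure P \<omega> FQ =
     measure_pmf (embed_pmf (wgtQ P \<omega>)) \<Otimes>\<^sub>M
     uniform_measure lborel {0..1} \<Otimes>\<^sub>M
     (\<Pi>\<^sub>M i\<in>UNIV. density lborel (exponential_density (alpha_plusQ P \<omega> i))) \<Otimes>\<^sub>M
     (\<Pi>\<^sub>M i\<in>UNIV. density lborel (exponential_density (alpha_minusQ P \<omega> i))) \<Otimes>\<^sub>M
     (\<Pi>\<^sub>M i\<in>UNIV. FQ i)"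

definition sampling_measure ::
    "('i::finite) risk_params \<Rightarrow> real \<Rightarrow> ('i \<Rightarrow> real measure) \<Rightarrow> (nat \<Rightarrow> 'i draws) measure" where
  "sampling_measure P \<omega> FQ = (\<Pi>\<^sub>M n\<in>UNIV. round_measure P \<omega> FQ)"

datatype 'i mode = NewCycle | InLoop 'i | Exited

text \<open>A state of the algorithm: the point of control, \<open>X\<close> and \<open>L\<close>.\<close>

type_synonym 'i state = "'i mode \<times> real \<times> real"

definition loop_body ::
    "'i risk_params \<Rightarrow> real \<Rightarrow> real \<Rightarrow> 'i draws \<Rightarrow> 'i \<Rightarrow> real \<Rightarrow> real \<Rightarrow> 'i state" where
  "loop_body P \<omega> u dr i x l = (case dr of (_, _, ap, am, bb) \<Rightarrow>
     let l1 = l * (totrateQ P \<omega> i / totrate P i) * (arr P i / arrQ P \<omega> i);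
         x2 = x + ap i;
         l2 = l1 * (alpha_plus P i / alpha_plusQ P \<omega> i)
                 * exp (- (alpha_plus P i - alpha_plusQ P \<omega> i) * ap i)
     in if x2 > u then (Exited, x2, l2)
        else
          let x3 = x2 - am i;
              l3 = l2 * (alpha_minus P i / alpha_minusQ P \<omega> i)
                      * exp (- (alpha_minus P i - alpha_minusQ P \<omega> i) * am i);
              x4 = x3 + bb i;
              l4 = l3 * exp (- \<omega> * bb i) * bfun P i (- \<omega>)
          in if x4 > u then (Exited, x4, l4) else (InLoop i, x4, l4))"

definition cycle_end ::
    "'i risk_params \<Rightarrow> real \<Rightarrow> real \<Rightarrow> 'i draws \<Rightarrow> 'i \<Rightarrow> real \<Rightarrow> real \<Rightarrow> 'i state" where
  "cycle_end P \<omega> u dr i x l = (case dr of (_, _, ap, am, _) \<Rightarrow>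
     let l1 = l * (totrateQ P \<omega> i / totrate P i) * (qrate P / qrateQ P \<omega> i);
         x2 = x + ap i;
         l2 = l1 * (alpha_plus P i / alpha_plusQ P \<omega> i)
                 * exp (- (alpha_plus P i - alpha_plusQ P \<omega> i) * ap i)
     in if x2 > u then (Exited, x2, l2)
        else
          (NewCycle, x2 - am i,
           l2 * (alpha_minus P i / alpha_minusQ P \<omega> i)
              * exp (- (alpha_minus P i - alpha_minusQ P \<omega> i) * am i)))"

definition loop_test ::
    "'i risk_params \<Rightarrow> real \<Rightarrow> real \<Rightarrow> 'i draws \<Rightarrow> 'i \<Rightarrow> real \<Rightarrow> real \<Rightarrow> 'i state" where
  "loop_test P \<omega> u dr i x l = (case dr of (_, v, _) \<Rightarrow>
     if v < arrQ P \<omega> i / totrateQ P \<omega> i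
     then loop_body P \<omega> u dr i x l else cycle_end P \<omega> u dr i x l)"

definition round_step ::
    "'i risk_params \<Rightarrow> real \<Rightarrow> real \<Rightarrow> 'i draws \<Rightarrow> 'i state \<Rightarrow> 'i state" where
  "round_step P \<omega> u dr st = (case st of (md, x, l) \<Rightarrow>
     case md of
       NewCycle \<Rightarrow>
         (let i = fst dr in loop_test P \<omega> u dr i x (l * (wgt P i / wgtQ P \<omega> i)))
     | InLoop i \<Rightarrow> loop_test P \<omega> u dr i x l
     | Exited \<Rightarrow> st)"

primrec run ::
    "'i risk_params \<Rightarrow> real \<Rightarrow> real \<Rightarrow> (nat \<Rightarrow> 'i draws) \<Rightarrow> nat \<Rightarrow> 'i state" where
  "run P \<omega> u ds 0 = (NewCycle, 0, 1)"
| "run P \<omega> u ds (Suc n) = round_step P \<omega> u (ds n) (run P \<omega> u ds n)"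

text \<open>The returned value of \<open>L\<close>; the value \<open>0\<close> is assigned to the runs that never exit, which
  have probability zero when \<open>\<omega>\<close> is the root of \<open>E exp (\<omega> Y) = 1\<close>.\<close>

definition estimate ::
    "'i risk_params \<Rightarrow> real \<Rightarrow> real \<Rightarrow> (nat \<Rightarrow> 'i draws) \<Rightarrow> real" where
  "estimate P \<omega> u ds =
     (if \<exists>n. fst (run P \<omega> u ds n) = Exited
      then snd (snd (run P \<omega> u ds (LEAST n. fst (run P \<omega> u ds n) = Exited)))
      else 0)"

section \<open>Laplace exponents\<close>

lemma sets_process_sigma:
  "sets (sigma (space M) {Z t -` A \<inter> space M | t A. t \<in> I \<and> A \<in> sets N}) = process_sets M I N Z"
  unfolding process_sets_def by (intro sets_measure_of) auto

lemma space_process_sigma: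
  "space (sigma (space M) {Z t -` A \<inter> space M | t A. t \<in> I \<and> A \<in> sets N}) = space M"
  by (intro space_measure_of) auto

lemma measurable_process_sigma:
  assumes "t \<in> I" and "space N = UNIV"
  shows "Z t \<in> measurable (sigma (space M) {Z t -` A \<inter> space M | t A. t \<in> I \<and> A \<in> sets N}) N"
  using assms
  by (intro measurableI)
     (auto simp: sets_process_sigma process_sets_def space_process_sigma intro!: sigma_sets.Basic)

lemma (in prob_space) indep_set_nn_integral:
  fixes f g :: "'a \<Rightarrow> ennreal"
  assumes ind: "indep_set A B" 
    and "sets MA = A" "sets MB = B" "space MA = space M" "space MB = space M"
    and f: "f \<in> borel_measurable MA" and g: "g \<in> borel_measurable MB"
  shows "(\<integral>\<^sup>+ w. f w * g w \<partial>M) = (\<integral>\<^sup>+ w. f w \<partial>M) * (\<integral>\<^sup>+ w. g w \<partial>M)"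
proof -
  have sub: "A \<subseteq> events" "B \<subseteq> events" using indep_setD_ev1[OF ind] indep_setD_ev2[OF ind] .
  have fM: "f \<in> borel_measurable M" and gM: "g \<in> borel_measurable M"
    using measurable_mono[of borel borel MA M] measurable_mono[of borel borel MB M] f g sub assms
    by auto
  have "{f -` X \<inter> space M | X. X \<in> sets borel} \<subseteq> sets MA"
    using measurable_sets[OF f] assms(4) by auto
  from sets.sigma_sets_subset[OF this]
  have fs: "sigma_sets (space M) {f -` X \<inter> space M | X. X \<in> sets borel} \<subseteq> A"
    unfolding assms(2) assms(4) .
  have "{g -` X \<inter> space M | X. X \<in> sets borel} \<subseteq> sets MB"
    using measurable_sets[OF g] assms(5) by auto
  from sets.sigma_sets_subset[OF this]
  have gs: "sigma_sets (space M) {g -` X \<inter> space M | X. X \<in> sets borel} \<subseteq> B"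
    unfolding assms(3) assms(5) .
  have "indep_set (sigma_sets (space M) {f -` X \<inter> space M | X. X \<in> sets borel})
      (sigma_sets (space M) {g -` X \<inter> space M | X. X \<in> sets borel})"
    using indep_setD[OF ind] fs gs sub by (intro indep_setI) blast+
  then have "indep_var borel f borel g"
    unfolding indep_var_eq using fM gM by blast
  moreover have "case_bool borel borel = (\<lambda>_. borel :: ennreal measure)"
    by (auto split: bool.split)
  ultimately have "indep_vars (\<lambda>_. borel) (case_bool f g) UNIV"
    unfolding indep_var_def by simp
  from indep_vars_nn_integral[OF _ this] show ?thesis
    by (simp add: UNIV_bool mult.commute)
qed

lemma (in prob_space) normal_laplace:
  assumes "distributed M lborel Z (normal_density 0 1)"
  shows "(\<integral>\<^sup>+ w. ennreal (exp (- s * Z w)) \<partial>M) = ennreal (exp (s\<^sup>2 / 2))"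
proof -
  have "(\<integral>\<^sup>+ w. ennreal (exp (- s * Z w)) \<partial>M) =
      (\<integral>\<^sup>+ x. ennreal (normal_density 0 1 x) * ennreal (exp (- s * x)) \<partial>lborel)"
    by (rule distributed_nn_integral[OF assms, symmetric]) simp
  also have "\<dots> = (\<integral>\<^sup>+ x. ennreal (exp (s\<^sup>2 / 2)) * ennreal (normal_density (- s) 1 x) \<partial>lborel)"
    by (intro nn_integral_cong)
       (simp add: ennreal_mult[symmetric] normal_density_def exp_add[symmetric] power2_eq_square
          field_simps)
  also have "\<dots> = ennreal (exp (s\<^sup>2 / 2)) * (\<integral>\<^sup>+ x. ennreal (normal_density (- s) 1 x) \<partial>lborel)"
    by (rule nn_integral_cmult) simp
  also have "(\<integral>\<^sup>+ x. ennreal (normal_density (- s) 1 x) \<partial>lborel) = 1"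
    by (subst nn_integral_eq_integral) auto
  finally show ?thesis by simp
qed

lemma (in prob_space) poisson_epochs_prob:
  assumes S: "poisson_epochs M c S" and c: "0 < c"
  shows "prob {w\<in>space M. S n w \<le> 1} = 1 - (\<Sum>j<n. c ^ j * exp (- c) / fact j)"
proof (cases n)
  case 0
  then have "{w\<in>space M. S n w \<le> 1} = space M" using S by (auto simp: poisson_epochs_def)
  then show ?thesis using 0 by (simp add: prob_space)
next
  case (Suc m)
  have "distributed M lborel (\<lambda>w. \<Sum>k<n. S (Suc k) w - S k w) (erlang_density (card {..<n} - 1) c)"
    using S Suc unfolding poisson_epochs_def
    by (intro exponential_distributed_sum c) (auto intro: indep_vars_subset)
  from erlang_distributed_le[OF this c, of 1]
  have "prob {w\<in>space M. (\<Sum>k<n. S (Suc k) w - S k w) \<le> 1} = erlang_CDF m c 1"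
    by (simp add: Suc)
  moreover have "{w\<in>space M. (\<Sum>k<n. S (Suc k) w - S k w) \<le> 1} = {w\<in>space M. S n w \<le> 1}"
    using S sum_lessThan_telescope[of "\<lambda>k. S k w" n for w] by (auto simp: poisson_epochs_def)
  ultimately show ?thesis
    by (simp add: erlang_CDF_def Suc lessThan_Suc_atMost)
qed


lemma compound_poisson_laplace:
  assumes "prob_space M" and c: "0 < c" and F: "real_distribution F"
    and Z: "compound_poisson M c F Z"
  shows "laplace_transform M (Z 1) \<alpha> =
    (\<Sum>n. ennreal (c ^ n * exp (- c) / fact n) * laplace_transform F (\<lambda>x. x) \<alpha> ^ n)"
proof -
  interpret prob_space M by fact
  interpret F: real_distribution F by fact
  obtain S C where S: "poisson_epochs M c S"
    and C: "indep_vars (\<lambda>_. borel) C (UNIV :: nat set)" "\<And>k. distr M borel (C k) = F"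
    and SC: "indep_set (process_sets M UNIV borel S) (process_sets M UNIV borel C)"
    and Zeq: "\<And>w. w \<in> space M \<Longrightarrow> Z 1 w = (\<Sum>k<epoch_count S 1 w. C k w)"
    using Z unfolding compound_poisson_def by fastforce
  define MS where "MS = sigma (space M) {S t -` A \<inter> space M | t A. t \<in> UNIV \<and> A \<in> sets borel}"
  define MC where "MC = sigma (space M) {C t -` A \<inter> space M | t A. t \<in> UNIV \<and> A \<in> sets borel}"
  have MSC: "sets MS = process_sets M UNIV borel S" "sets MC = process_sets M UNIV borel C"
    "space MS = space M" "space MC = space M"
    unfolding MS_def MC_def by (simp_all only: sets_process_sigma space_process_sigma)
  have SMS[measurable]: "S n \<in> borel_measurable MS" for n
    unfolding MS_def by (rule measurable_process_sigma) auto
  have CMC[measurable]: "C n \<in> borel_measurable MC" for n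
    unfolding MC_def by (rule measurable_process_sigma) auto
  have sub: "sets MS \<subseteq> events" "sets MC \<subseteq> events"
    using indep_setD_ev1[OF SC] indep_setD_ev2[OF SC] MSC by auto
  have SM[measurable]: "S n \<in> borel_measurable M" for n
    using SMS[of n] sub(1) MSC by (auto simp: measurable_def)
  have CM[measurable]: "C n \<in> borel_measurable M" for n
    using CMC[of n] sub(2) MSC by (auto simp: measurable_def)
  have mono: "strict_mono (\<lambda>n. S n w)" if "w \<in> space M" for w
    using S that by (auto simp: poisson_epochs_def)
  define A where "A n = {w\<in>space M. S n w \<le> 1 \<and> 1 < S (Suc n) w}" for n
  have A_MS: "A n \<in> sets MS" for n
    unfolding A_def MSC(3)[symmetric] by measurable
  have A_M[measurable]: "A n \<in> events" for n using A_MS sub by auto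
  have count: "epoch_count S 1 w = n" if w: "w \<in> A n" for w n
  proof -
    have "{k. 1 \<le> k \<and> S k w \<le> 1} = {1..n}"
    proof (intro set_eqI iffI)
      fix k assume k: "k \<in> {k. 1 \<le> k \<and> S k w \<le> 1}"
      have "\<not> Suc n \<le> k"
      proof
        assume "Suc n \<le> k"
        then have "S (Suc n) w \<le> S k w"
          using strict_mono_leD[OF mono[of w]] w by (auto simp: A_def)
        then show False using k w by (auto simp: A_def)
      qed
      then show "k \<in> {1..n}" using k by auto
    next
      fix k assume k: "k \<in> {1..n}"
      then have "S k w \<le> S n w"
        using strict_mono_leD[OF mono[of w]] w by (auto simp: A_def)
      then show "k \<in> {k. 1 \<le> k \<and> S k w \<le> 1}" using k w by (auto simp: A_def)
    qed
    then show ?thesis by (simp add: epoch_count_def)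
  qed
  have disj: "disjoint_family A"
    unfolding disjoint_family_on_def using count by blast
  have pA: "prob (A n) = c ^ n * exp (- c) / fact n" for n
  proof -
    have "{w\<in>space M. S n w \<le> 1} = A n \<union> {w\<in>space M. S (Suc n) w \<le> 1}"
      using mono by (auto simp: A_def) (metis lessI less_eq_real_def order_trans strict_mono_less)
    moreover have "A n \<inter> {w\<in>space M. S (Suc n) w \<le> 1} = {}" by (auto simp: A_def)
    ultimately have "prob {w\<in>space M. S n w \<le> 1} = prob (A n) + prob {w\<in>space M. S (Suc n) w \<le> 1}"
      by (simp add: finite_measure_Union)
    then show ?thesis by (simp add: poisson_epochs_prob[OF S c])
  qed
  have "(\<lambda>n. c ^ n /\<^sub>R fact n * exp (- c)) sums (exp c * exp (- c))"
    by (intro sums_mult2 exp_converges)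
  then have "(\<lambda>n. prob (A n)) sums 1"
    by (simp add: pA exp_add[symmetric] divide_inverse mult_ac)
  moreover have "(\<lambda>n. prob (A n)) sums prob (\<Union>n. A n)"
    using disj by (intro finite_measure_UNION) auto
  ultimately have "prob (\<Union>n. A n) = 1" using sums_unique2 by blast
  then have AE: "AE w in M. w \<in> (\<Union>n. A n)"
    by (subst (asm) prob_eq_1) auto
  have decomp: "AE w in M. ennreal (exp (- \<alpha> * Z 1 w)) =
      (\<Sum>n. indicator (A n) w * (\<Prod>k<n. ennreal (exp (- \<alpha> * C k w))))"
    using AE
  proof eventually_elim
    fix w assume "w \<in> (\<Union>n. A n)"
    then obtain n where n: "w \<in> A n" by auto
    then have wM: "w \<in> space M" by (auto simp: A_def)
    have other: "indicator (A m) w = (0::ennreal)" if "m \<noteq> n" for m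
      using disj n that by (auto simp: disjoint_family_on_def indicator_def)
    have "(\<Sum>m. indicator (A m) w * (\<Prod>k<m. ennreal (exp (- \<alpha> * C k w)))) =
        (\<Sum>m\<in>{n}. indicator (A m) w * (\<Prod>k<m. ennreal (exp (- \<alpha> * C k w))))"
      by (intro suminf_finite) (auto simp: other)
    also have "\<dots> = (\<Prod>k<n. ennreal (exp (- \<alpha> * C k w)))" using n by simp
    also have "\<dots> = ennreal (exp (- \<alpha> * Z 1 w))"
      by (simp add: Zeq[OF wM] count[OF n] prod_ennreal exp_sum[symmetric] sum_distrib_left)
    finally show "ennreal (exp (- \<alpha> * Z 1 w)) =
      (\<Sum>n. indicator (A n) w * (\<Prod>k<n. ennreal (exp (- \<alpha> * C k w))))" by simp
  qed
  have prodC: "(\<integral>\<^sup>+ w. (\<Prod>k<n. ennreal (exp (- \<alpha> * C k w))) \<partial>M) =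
      laplace_transform F (\<lambda>x. x) \<alpha> ^ n" for n
  proof -
    have "indep_vars (\<lambda>_. borel) (\<lambda>k w. ennreal (exp (- \<alpha> * C k w))) {..<n}"
      by (rule indep_vars_compose2[OF indep_vars_subset[OF C(1)]]) auto
    from indep_vars_nn_integral[OF _ this]
    have "(\<integral>\<^sup>+ w. (\<Prod>k<n. ennreal (exp (- \<alpha> * C k w))) \<partial>M) =
        (\<Prod>k<n. \<integral>\<^sup>+ w. ennreal (exp (- \<alpha> * C k w)) \<partial>M)" by simp
    moreover have "(\<integral>\<^sup>+ w. ennreal (exp (- \<alpha> * C k w)) \<partial>M) = laplace_transform F (\<lambda>x. x) \<alpha>" for k
      unfolding laplace_transform_def C(2)[of k, symmetric] by (subst nn_integral_distr) auto
    ultimately show ?thesis by simp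
  qed
  have "laplace_transform M (Z 1) \<alpha> =
      (\<integral>\<^sup>+ w. (\<Sum>n. indicator (A n) w * (\<Prod>k<n. ennreal (exp (- \<alpha> * C k w)))) \<partial>M)"
    unfolding laplace_transform_def by (rule nn_integral_cong_AE[OF decomp])
  also have "\<dots> = (\<Sum>n. \<integral>\<^sup>+ w. indicator (A n) w * (\<Prod>k<n. ennreal (exp (- \<alpha> * C k w))) \<partial>M)"
    by (intro nn_integral_suminf) measurable
  also have "\<dots> = (\<Sum>n. (\<integral>\<^sup>+ w. indicator (A n) w \<partial>M) *
      (\<integral>\<^sup>+ w. (\<Prod>k<n. ennreal (exp (- \<alpha> * C k w))) \<partial>M))"
    by (intro suminf_cong indep_set_nn_integral[OF SC MSC]
        borel_measurable_indicator A_MS borel_measurable_prod_ennreal) measurable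
  also have "\<dots> = (\<Sum>n. ennreal (c ^ n * exp (- c) / fact n) * laplace_transform F (\<lambda>x. x) \<alpha> ^ n)"
    by (simp only: prodC nn_integral_indicator A_M emeasure_eq_measure pA)
  finally show ?thesis .
qed

lemma claims_levy_laplace_product:
  assumes "prob_space M" and c: "0 < c" and F: "real_distribution F"
    and X: "claims_levy M r \<sigma> c F X"
  shows "laplace_transform M (X 1) \<alpha> = ennreal (exp (r * \<alpha> + \<sigma>\<^sup>2 * \<alpha>\<^sup>2 / 2)) *
    (\<Sum>n. ennreal (c ^ n * exp (- c) / fact n) * laplace_transform F (\<lambda>x. x) \<alpha> ^ n)"
proof -
  interpret prob_space M by fact
  obtain W Z where W: "brownian_motion M W" and Z: "compound_poisson M c F Z"
    and WZ: "indep_set (process_sets M {0..} borel W) (process_sets M {0..} borel Z)"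
    and Xeq: "\<And>w. w \<in> space M \<Longrightarrow> X 1 w = - r + \<sigma> * W 1 w + Z 1 w"
    using X unfolding claims_levy_def by (metis mult.right_neutral zero_le_one)
  define MW where "MW = sigma (space M) {W t -` A \<inter> space M | t A. t \<in> {0..} \<and> A \<in> sets borel}"
  define MZ where "MZ = sigma (space M) {Z t -` A \<inter> space M | t A. t \<in> {0..} \<and> A \<in> sets borel}"
  have MWZ: "sets MW = process_sets M {0..} borel W" "sets MZ = process_sets M {0..} borel Z"
    "space MW = space M" "space MZ = space M"
    unfolding MW_def MZ_def by (simp_all only: sets_process_sigma space_process_sigma)
  have WM[measurable]: "W 1 \<in> borel_measurable MW"
    unfolding MW_def by (rule measurable_process_sigma) auto
  have ZM[measurable]: "Z 1 \<in> borel_measurable MZ"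
    unfolding MZ_def by (rule measurable_process_sigma) auto
  have sub: "sets MW \<subseteq> events" "sets MZ \<subseteq> events"
    using indep_setD_ev1[OF WZ] indep_setD_ev2[OF WZ] MWZ by auto
  have [measurable]: "W 1 \<in> borel_measurable M" "Z 1 \<in> borel_measurable M"
    using WM ZM sub MWZ by (auto simp: measurable_def)
  have "distributed M lborel (\<lambda>w. W 1 w - W 0 w) (normal_density 0 1)"
  proof -
    have "\<forall>s t. 0 \<le> s \<and> s < t \<longrightarrow>
        distributed M lborel (\<lambda>w. W t w - W s w) (normal_density 0 (sqrt (t - s)))"
      using W unfolding brownian_motion_def by blast
    from this[rule_format, of 0 1] show ?thesis by simp
  qed
  then have gauss: "(\<integral>\<^sup>+ w. ennreal (exp (- (\<alpha> * \<sigma>) * (W 1 w - W 0 w))) \<partial>M) = 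
      ennreal (exp ((\<alpha> * \<sigma>)\<^sup>2 / 2))"
    by (rule normal_laplace)
  have "laplace_transform M (X 1) \<alpha> =
      (\<integral>\<^sup>+ w. ennreal (exp (r * \<alpha>)) *
         (ennreal (exp (- (\<alpha> * \<sigma>) * W 1 w)) * ennreal (exp (- \<alpha> * Z 1 w))) \<partial>M)"
    unfolding laplace_transform_def
    by (intro nn_integral_cong)
       (simp add: Xeq ennreal_mult[symmetric] exp_add[symmetric] algebra_simps)
  also have "\<dots> = ennreal (exp (r * \<alpha>)) *
      (\<integral>\<^sup>+ w. ennreal (exp (- (\<alpha> * \<sigma>) * W 1 w)) * ennreal (exp (- \<alpha> * Z 1 w)) \<partial>M)"
    by (rule nn_integral_cmult) measurable
  also have "(\<integral>\<^sup>+ w. ennreal (exp (- (\<alpha> * \<sigma>) * W 1 w)) * ennreal (exp (- \<alpha> * Z 1 w)) \<partial>M) =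
      (\<integral>\<^sup>+ w. ennreal (exp (- (\<alpha> * \<sigma>) * W 1 w)) \<partial>M) * laplace_transform M (Z 1) \<alpha>"
    unfolding laplace_transform_def
    by (rule indep_set_nn_integral[OF WZ MWZ]) measurable
  also have "(\<integral>\<^sup>+ w. ennreal (exp (- (\<alpha> * \<sigma>) * W 1 w)) \<partial>M) = ennreal (exp ((\<alpha> * \<sigma>)\<^sup>2 / 2))"
    unfolding gauss[symmetric] using W
    by (intro nn_integral_cong) (auto simp: brownian_motion_def)
  finally have *: "laplace_transform M (X 1) \<alpha> =
      ennreal (exp (r * \<alpha>)) * (ennreal (exp ((\<alpha> * \<sigma>)\<^sup>2 / 2)) * laplace_transform M (Z 1) \<alpha>)" .
  have "exp (r * \<alpha>) * exp ((\<alpha> * \<sigma>)\<^sup>2 / 2) = exp (r * \<alpha> + \<sigma>\<^sup>2 * \<alpha>\<^sup>2 / 2)"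
    by (simp only: exp_add power_mult_distrib mult.commute[of "\<alpha>\<^sup>2"])
  then have "ennreal (exp (r * \<alpha>)) * ennreal (exp ((\<alpha> * \<sigma>)\<^sup>2 / 2)) =
      ennreal (exp (r * \<alpha> + \<sigma>\<^sup>2 * \<alpha>\<^sup>2 / 2))"
    by (simp only: ennreal_mult'[symmetric] exp_ge_zero)
  then show ?thesis
    unfolding * mult.assoc[symmetric]
    by (simp only: compound_poisson_laplace[OF assms(1) c F Z])
qed

lemma claims_levy_laplace:
  assumes "prob_space M" and "0 < c" and "real_distribution F" and "claims_levy M r \<sigma> c F X"
  shows "laplace_transform M (X 1) \<alpha> < \<infinity> \<longleftrightarrow> laplace_transform F (\<lambda>x. x) \<alpha> < \<infinity>"
    and "laplace_transform F (\<lambda>x. x) \<alpha> < \<infinity> \<Longrightarrow>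
      ln (enn2real (laplace_transform M (X 1) \<alpha>)) =
        r * \<alpha> + \<sigma>\<^sup>2 * \<alpha>\<^sup>2 / 2 - c + c * enn2real (laplace_transform F (\<lambda>x. x) \<alpha>)"
proof -
  let ?b = "laplace_transform F (\<lambda>x. x) \<alpha>"
  let ?g = "exp (r * \<alpha> + \<sigma>\<^sup>2 * \<alpha>\<^sup>2 / 2)"
  let ?s = "\<Sum>n. ennreal (c ^ n * exp (- c) / fact n) * ?b ^ n"
  note eq = claims_levy_laplace_product[OF assms, of \<alpha>]
  have fin: "laplace_transform M (X 1) \<alpha> = ennreal (?g * exp (- c + c * enn2real ?b))" if b: "?b < \<infinity>"
  proof -
    define B where "B = enn2real ?b"
    have B: "?b = ennreal B" "0 \<le> B" using b by (auto simp: B_def)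
    have "(\<lambda>n. exp (- c) * ((c * B) ^ n /\<^sub>R fact n)) sums (exp (- c) * exp (c * B))"
      by (intro sums_mult exp_converges)
    then have "(\<lambda>n. c ^ n * exp (- c) / fact n * B ^ n) sums exp (- c + c * B)"
      unfolding exp_add by (simp add: power_mult_distrib divide_inverse mult_ac)
    then have "(\<Sum>n. ennreal (c ^ n * exp (- c) / fact n * B ^ n)) = ennreal (exp (- c + c * B))"
      using assms(2) B by (intro suminf_ennreal_eq) auto
    moreover have "ennreal (c ^ n * exp (- c) / fact n) * ?b ^ n =
        ennreal (c ^ n * exp (- c) / fact n * B ^ n)" for n
      unfolding B(1) ennreal_power[OF B(2)] using B(2) by (intro ennreal_mult''[symmetric]) simp
    ultimately have "?s = ennreal (exp (- c + c * B))" by (simp only:)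
    then show ?thesis unfolding eq B_def by (simp add: ennreal_mult)
  qed
  have inf: "laplace_transform M (X 1) \<alpha> = \<infinity>" if b: "?b = \<infinity>"
  proof -
    have "(\<Sum>n\<in>{1}. ennreal (c ^ n * exp (- c) / fact n) * ?b ^ n) \<le> ?s"
      by (intro sum_le_suminf) auto
    then have "?s = \<infinity>" using b assms(2) by (simp add: ennreal_mult_top top_unique)
    then show ?thesis unfolding eq by (simp add: ennreal_mult_top)
  qed
  show "laplace_transform M (X 1) \<alpha> < \<infinity> \<longleftrightarrow> ?b < \<infinity>"
  proof (cases "?b = \<infinity>")
    case True
    then show ?thesis using inf by simp
  next
    case False
    then have "?b < \<infinity>" by (simp add: less_top[symmetric])
    then show ?thesis using fin by simp
  qed
  show "ln (enn2real (laplace_transform M (X 1) \<alpha>)) =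
        r * \<alpha> + \<sigma>\<^sup>2 * \<alpha>\<^sup>2 / 2 - c + c * enn2real ?b" if "?b < \<infinity>"
    using fin[OF that] by (simp add: ln_mult)
qed

lemma resampled_model_phi:
  assumes "resampled_model M P X T J"
  shows "laplace_transform M (X i 1) \<alpha> < \<infinity> \<longleftrightarrow> claim_lt P i \<alpha> < \<infinity>"
    and "claim_lt P i \<alpha> < \<infinity> \<Longrightarrow> ln (enn2real (laplace_transform M (X i 1) \<alpha>)) = phi P i \<alpha>"
proof -
  have *: "prob_space M" "0 < arr P i" "real_distribution (claim P i)"
    "claims_levy M (prem P i) (vol P i) (arr P i) (claim P i) (X i)"
    using assms by (simp_all add: resampled_model_def)
  show "laplace_transform M (X i 1) \<alpha> < \<infinity> \<longleftrightarrow> claim_lt P i \<alpha> < \<infinity>"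
    unfolding claim_lt_def by (rule claims_levy_laplace(1)[OF *])
  show "claim_lt P i \<alpha> < \<infinity> \<Longrightarrow> ln (enn2real (laplace_transform M (X i 1) \<alpha>)) = phi P i \<alpha>"
    unfolding claim_lt_def phi_def by (rule claims_levy_laplace(2)[OF *])
qed

text \<open>A distribution with transform \<open>claim_ltQ\<close> exists: the exponentially tilted claim
  distribution.\<close>

lemma claim_distributionQ_exists:
  assumes F: "real_distribution F" and fin: "laplace_transform F (\<lambda>x. x) (- \<omega>) < \<infinity>"
  defines "G \<equiv> density F (\<lambda>x. ennreal (exp (\<omega> * x)) / laplace_transform F (\<lambda>x. x) (- \<omega>))"
  shows "real_distribution G"
    and "laplace_transform G (\<lambda>x. x) \<alpha> =
      laplace_transform F (\<lambda>x. x) (\<alpha> - \<omega>) / laplace_transform F (\<lambda>x. x) (- \<omega>)"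
proof -
  interpret F: real_distribution F by fact
  let ?b = "laplace_transform F (\<lambda>x. x) (- \<omega>)"
  have "?b \<noteq> 0"
    unfolding laplace_transform_def by (subst nn_integral_0_iff_AE) auto
  have G: "laplace_transform G (\<lambda>x. x) \<alpha> = laplace_transform F (\<lambda>x. x) (\<alpha> - \<omega>) / ?b" for \<alpha>
  proof -
    have "laplace_transform G (\<lambda>x. x) \<alpha> =
        (\<integral>\<^sup>+ x. ennreal (exp (\<omega> * x)) / ?b * ennreal (exp (- \<alpha> * x)) \<partial>F)"
      unfolding G_def laplace_transform_def[of _ _ \<alpha>] by (subst nn_integral_density) auto
    also have "\<dots> = (\<integral>\<^sup>+ x. ennreal (exp (- (\<alpha> - \<omega>) * x)) / ?b \<partial>F)"
      by (intro nn_integral_cong)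
         (simp add: divide_ennreal_def mult_ac ennreal_mult[symmetric] exp_add[symmetric] algebra_simps
           mult.assoc[symmetric] flip: mult.assoc)
    finally show ?thesis by (simp add: nn_integral_divide laplace_transform_def)
  qed
  show "laplace_transform G (\<lambda>x. x) \<alpha> = laplace_transform F (\<lambda>x. x) (\<alpha> - \<omega>) / ?b" by (rule G)
  have "emeasure G (space G) = laplace_transform G (\<lambda>x. x) 0"
    by (simp add: laplace_transform_def)
  also have "\<dots> = 1" using G[of 0] \<open>?b \<noteq> 0\<close> fin by (simp add: less_top)
  finally have "prob_space G" by (rule prob_spaceI)
  then show "real_distribution G"
    by (simp add: real_distribution_def real_distribution_axioms_def G_def)
qed

end

theory Submission
  imports Defs
begin

text \<open>
  The algorithm samples from an exponential change of measure, so its likelihood ratio should be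
  a function of the current position alone, namely \<open>L = exp (- \<omega> * X)\<close>, up to the part of a
  cycle still in progress. Reading off the constants confirms this. Write \<open>f\<close>,
  \<open>\<alpha>\<^sub>+\<close>, \<open>\<alpha>\<^sub>-\<close> for the killing rate and the two ladder rates of a regime. The numbers \<open>\<alpha>\<^sub>-\<close>
  and \<open>- \<alpha>\<^sub>+\<close> are the roots \<open>z\<close> of \<open>r * z + \<sigma>\<^sup>2 * z\<^sup>2 / 2 = f\<close>, and passing to the tilted
  parameters translates this quadratic by \<open>\<omega>\<close>. Therefore \<open>\<alpha>\<^sub>+\<close> loses \<open>\<omega>\<close> and \<open>\<alpha>\<^sub>-\<close> gains \<open>\<omega>\<close>, so the
  exponential factors attached to an upward and a downward step are \<open>exp (- \<omega> * \<bbbA>\<^sup>+)\<close> and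
  \<open>exp (\<omega> * \<bbbA>\<^sup>-)\<close>. Moreover \<open>f = \<sigma>\<^sup>2 / 2 * \<alpha>\<^sub>+ * \<alpha>\<^sub>-\<close> holds before and after the tilt, so the
  constants \<open>f\<^sup>Q / f\<close>, \<open>\<alpha>\<^sub>+ / \<alpha>\<^sub>+\<^sup>Q\<close> and \<open>\<alpha>\<^sub>- / \<alpha>\<^sub>-\<^sup>Q\<close> multiply to 1 (\<open>ladder_ratio\<close>). The constants of a
  claim also cancel, and the factor \<open>p / p\<^sup>Q = q\<^sup>Q / q\<close> paid when a regime is drawn is returned when
  the cycle ends.

  What remains is a constant that depends only on the regime and on where the algorithm stops. The
  invariant \<open>tilted_state\<close> records this, and at exit, where \<open>X > u\<close>, it yields the deterministic
  bound \<open>0 \<le> L \<le> K * exp (- \<omega> * u)\<close> with \<open>K\<close> independent of \<open>u\<close> (\<open>estimate_bounds\<close>). The second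
  moment of \<open>L\<close> is then at most \<open>K\<^sup>2 * exp (- 2 * \<omega> * u)\<close>, which is of the order of the squared ruin
  probability by the assumed asymptotics.\<close>

section \<open>Tilting the ladder rates\<close>

text \<open>The two rates are, up to sign, the roots of a quadratic with leading coefficient
  \<open>\<sigma>\<^sup>2 / 2\<close> and constant term \<open>- f\<close>; the product formula is Vieta's.\<close>

lemma wiener_hopf_rates:
  fixes r f \<sigma> :: real
  assumes "\<sigma> \<noteq> 0" "f > 0"
  defines "s \<equiv> sqrt (r\<^sup>2 + 2 * f * \<sigma>\<^sup>2)"
  shows "(s + r) / \<sigma>\<^sup>2 > 0" "(s - r) / \<sigma>\<^sup>2 > 0"
    and "f = \<sigma>\<^sup>2 / 2 * ((s + r) / \<sigma>\<^sup>2) * ((s - r) / \<sigma>\<^sup>2)"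
proof -
  have pos: "\<sigma>\<^sup>2 > 0" "2 * f * \<sigma>\<^sup>2 > 0" using assms by simp_all
  have "\<bar>r\<bar> < s"
    unfolding s_def by (rule real_less_rsqrt) (use pos in simp)
  then show "(s + r) / \<sigma>\<^sup>2 > 0" "(s - r) / \<sigma>\<^sup>2 > 0"
    using pos by (auto intro!: divide_pos_pos)
  have "s\<^sup>2 = r\<^sup>2 + 2 * f * \<sigma>\<^sup>2"
    unfolding s_def using pos by (intro real_sqrt_pow2) (simp add: add_nonneg_nonneg)
  then have "(s + r) * (s - r) = 2 * f * \<sigma>\<^sup>2"
    by (simp add: power2_eq_square algebra_simps)
  moreover have "\<sigma>\<^sup>2 / 2 * ((s + r) / \<sigma>\<^sup>2) * ((s - r) / \<sigma>\<^sup>2) = (s + r) * (s - r) / (2 * \<sigma>\<^sup>2)"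
    using pos by simp
  ultimately show "f = \<sigma>\<^sup>2 / 2 * ((s + r) / \<sigma>\<^sup>2) * ((s - r) / \<sigma>\<^sup>2)"
    using pos by simp
qed

locale tilted_parameters =
  fixes P :: "('i::finite) risk_params" and \<omega> :: real
  assumes \<omega>_pos: "\<omega> > 0"
    and qrate_pos: "qrate P > 0"
    and vol_nonzero: "vol P i \<noteq> 0"
    and arr_pos: "arr P i > 0"
    and bfun_pos: "bfun P i (- \<omega>) > 0"
    and phi_less: "phi P i (- \<omega>) < qrate P"
begin

lemma arrQ_pos: "arrQ P \<omega> i > 0"
  by (simp add: arrQ_def arr_pos bfun_pos)

lemma qrateQ_pos: "qrateQ P \<omega> i > 0"
  by (simp add: qrateQ_def phi_less)

lemma totrate_pos: "totrate P i > 0"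
  by (simp add: totrate_def add_pos_pos arr_pos qrate_pos)

lemma totrateQ_pos: "totrateQ P \<omega> i > 0"
  by (simp add: totrateQ_def add_pos_pos arrQ_pos qrateQ_pos)

text \<open>The claim transform in the Laplace exponent at \<open>- \<omega>\<close> cancels against the tilted arrival rate.
  What is left is minus the value at \<open>- \<omega>\<close> of the quadratic \<open>r * z + \<sigma>\<^sup>2 * z\<^sup>2 / 2 - f\<close>.\<close>

lemma totrateQ_eq:
  "totrateQ P \<omega> i = totrate P i + prem P i * \<omega> - (vol P i)\<^sup>2 * \<omega>\<^sup>2 / 2"
  by (simp add: totrateQ_def totrate_def arrQ_def qrateQ_def phi_def algebra_simps)

text \<open>Translating the variable of a quadratic does not change its discriminant, so both ladder rates
  simply shift by \<open>\<omega>\<close>.\<close>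

lemma discriminant_tilt:
  "(premQ P \<omega> i)\<^sup>2 + 2 * totrateQ P \<omega> i * (vol P i)\<^sup>2 = (prem P i)\<^sup>2 + 2 * totrate P i * (vol P i)\<^sup>2"
  by (simp add: totrateQ_eq premQ_def power2_eq_square algebra_simps)

lemma alpha_plusQ_eq: "alpha_plusQ P \<omega> i = alpha_plus P i - \<omega>"
  unfolding alpha_plusQ_def alpha_plus_def discriminant_tilt
  unfolding premQ_def
  using vol_nonzero[of i] by (simp add: field_simps)

lemma alpha_minusQ_eq: "alpha_minusQ P \<omega> i = alpha_minus P i + \<omega>"
  unfolding alpha_minusQ_def alpha_minus_def discriminant_tilt
  unfolding premQ_def
  using vol_nonzero[of i] by (simp add: field_simps)

lemma alpha_pos:
  "alpha_plus P i > 0" "alpha_minus P i > 0" "alpha_plusQ P \<omega> i > 0" "alpha_minusQ P \<omega> i > 0"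
  unfolding alpha_plus_def alpha_minus_def alpha_plusQ_def alpha_minusQ_def
  by (intro wiener_hopf_rates vol_nonzero totrate_pos totrateQ_pos)+

text \<open>One killed Brownian excursion leaves no constant in the likelihood ratio. Both killing rates
  are a product of ladder rates with the same prefactor \<open>\<sigma>\<^sup>2 / 2\<close>.\<close>

lemma ladder_ratio:
  "(totrateQ P \<omega> i / totrate P i) * (alpha_plus P i / alpha_plusQ P \<omega> i) *
     (alpha_minus P i / alpha_minusQ P \<omega> i) = 1"
proof -
  have f: "totrate P i = (vol P i)\<^sup>2 / 2 * alpha_plus P i * alpha_minus P i"
    unfolding alpha_plus_def alpha_minus_def
    by (rule wiener_hopf_rates(3)[OF vol_nonzero totrate_pos])
  have fQ: "totrateQ P \<omega> i = (vol P i)\<^sup>2 / 2 * alpha_plusQ P \<omega> i * alpha_minusQ P \<omega> i"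
    unfolding alpha_plusQ_def alpha_minusQ_def
    by (rule wiener_hopf_rates(3)[OF vol_nonzero totrateQ_pos])
  show ?thesis
    unfolding f fQ using alpha_pos[of i] vol_nonzero[of i] by simp
qed

section \<open>The pathwise bound on the likelihood ratio\<close>

text \<open>The constant left over when the algorithm stops after the upward part of an excursion, before
  the downward part has cancelled it.\<close>

definition up_factor :: "'i \<Rightarrow> real" where
  "up_factor i = (totrateQ P \<omega> i / totrate P i) * (alpha_plus P i / alpha_plusQ P \<omega> i)"

text \<open>The three summands are the constants with which a run can exit in regime \<open>i\<close>: after the upward
  step inside the while-loop, after a claim, and after the upward step that ends a cycle. Summing
  over all regimes gives a common upper bound.\<close>

definition exit_bound :: real where
  "exit_bound = (\<Sum>i\<in>UNIV. qrateQ P \<omega> i / qrate P * (arr P i / arrQ P \<omega> i) * up_factor i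
      + qrateQ P \<omega> i / qrate P + up_factor i)"

lemma up_factor_pos: "up_factor i > 0"
  by (simp add: up_factor_def totrateQ_pos totrate_pos alpha_pos)

lemma up_factor_down: "up_factor i * (alpha_minus P i / alpha_minusQ P \<omega> i) = 1"
  unfolding up_factor_def by (rule ladder_ratio)

lemma exit_bound_ge:
  "qrateQ P \<omega> i / qrate P * (arr P i / arrQ P \<omega> i) * up_factor i \<le> exit_bound"
  "qrateQ P \<omega> i / qrate P \<le> exit_bound"
  "up_factor i \<le> exit_bound"
proof -
  let ?t = "\<lambda>i. qrateQ P \<omega> i / qrate P * (arr P i / arrQ P \<omega> i) * up_factor i"
  have nn: "0 \<le> ?t i" "0 \<le> qrateQ P \<omega> i / qrate P" "0 \<le> up_factor i" for i
    using qrateQ_pos[of i] qrate_pos arr_pos[of i] arrQ_pos[of i] up_factor_pos[of i] by simp_all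
  have "?t i + qrateQ P \<omega> i / qrate P + up_factor i \<le> exit_bound"
    unfolding exit_bound_def by (rule member_le_sum) (use nn in \<open>auto intro!: add_nonneg_nonneg\<close>)
  with nn[of i] show "?t i \<le> exit_bound" "qrateQ P \<omega> i / qrate P \<le> exit_bound" "up_factor i \<le> exit_bound"
    by linarith+
qed

lemma exit_bound_nonneg: "0 \<le> exit_bound"
  using exit_bound_ge(3)[of undefined] up_factor_pos[of undefined] by linarith

text \<open>An upper bound on \<open>L * exp (\<omega> * X)\<close> at each point of control. Inside the loop the factor
  \<open>q\<^sup>Q / q\<close> from drawing the regime is still outstanding.\<close>

definition mode_bound :: "'i mode \<Rightarrow> real" where
  "mode_bound md = (case md of
     NewCycle \<Rightarrow> 1 | InLoop i \<Rightarrow> qrateQ P \<omega> i / qrate P | Exited \<Rightarrow> exit_bound)"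

definition tilted_state :: "real \<Rightarrow> 'i state \<Rightarrow> bool" where
  "tilted_state u st \<longleftrightarrow> (case st of (md, x, l) \<Rightarrow>
     0 \<le> l \<and> l \<le> mode_bound md * exp (- \<omega> * x) \<and> (md = Exited \<longrightarrow> u < x))"

text \<open>Every update multiplies \<open>L\<close> by a constant \<open>g\<close> and by \<open>exp (- \<omega> * y)\<close>, where \<open>y\<close> is the
  displacement, so only the constants need to be compared.\<close>

lemma exp_scaled_le:
  fixes l :: real
  assumes "l \<le> c * exp (- \<omega> * x)" "0 \<le> g" "c * g \<le> c'"
  shows "l * g * exp (- \<omega> * y) \<le> c' * exp (- \<omega> * (x + y))"
proof -
  have "l * (g * exp (- \<omega> * y)) \<le> c * exp (- \<omega> * x) * (g * exp (- \<omega> * y))"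
    using assms by (intro mult_right_mono) auto
  also have "\<dots> = c * g * exp (- \<omega> * (x + y))"
    by (simp add: algebra_simps exp_add[symmetric] flip: exp_add mult.assoc)
  also have "\<dots> \<le> c' * exp (- \<omega> * (x + y))"
    using assms by (intro mult_right_mono) auto
  finally show ?thesis by (simp add: mult.assoc)
qed

text \<open>After a complete pass through the loop body all constants have cancelled, so the bound
  \<open>q\<^sup>Q / q\<close> is reproduced.\<close>

lemma tilted_loop_body:
  assumes l: "0 \<le> l" "l \<le> qrateQ P \<omega> i / qrate P * exp (- \<omega> * x)"
  shows "tilted_state u (loop_body P \<omega> u dr i x l)"
proof -
  obtain k v ap am bb where dr: "dr = (k, v, ap, am, bb)" by (cases dr)
  let ?l2 = "l * (totrateQ P \<omega> i / totrate P i) * (arr P i / arrQ P \<omega> i) *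
    (alpha_plus P i / alpha_plusQ P \<omega> i) * exp (- (alpha_plus P i - alpha_plusQ P \<omega> i) * ap i)"
  let ?l4 = "?l2 * (alpha_minus P i / alpha_minusQ P \<omega> i) *
    exp (- (alpha_minus P i - alpha_minusQ P \<omega> i) * am i) * exp (- \<omega> * bb i) * bfun P i (- \<omega>)"
  have l2: "?l2 = l * (arr P i / arrQ P \<omega> i * up_factor i) * exp (- \<omega> * ap i)"
    by (simp add: alpha_plusQ_eq up_factor_def mult_ac)
  have "?l4 = l * ((up_factor i * (alpha_minus P i / alpha_minusQ P \<omega> i)) *
      (arr P i / arrQ P \<omega> i * bfun P i (- \<omega>))) *
      (exp (- \<omega> * ap i) * exp (\<omega> * am i) * exp (- \<omega> * bb i))"
    unfolding l2 by (simp add: alpha_minusQ_eq mult_ac)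
  also have "\<dots> = l * 1 * exp (- \<omega> * (ap i - am i + bb i))"
    unfolding up_factor_down using arr_pos[of i] bfun_pos[of i]
    by (simp add: arrQ_def algebra_simps flip: exp_add)
  finally have l4: "?l4 = l * 1 * exp (- \<omega> * (ap i - am i + bb i))" .
  have g: "0 \<le> arr P i / arrQ P \<omega> i * up_factor i"
    using arr_pos[of i] arrQ_pos[of i] up_factor_pos[of i] by simp
  have "0 \<le> ?l2" unfolding l2 by (rule mult_nonneg_nonneg[OF mult_nonneg_nonneg[OF l(1) g] exp_ge_zero])
  moreover have "?l2 \<le> exit_bound * exp (- \<omega> * (x + ap i))"
    unfolding l2 using exit_bound_ge(1)[of i] by (intro exp_scaled_le[OF l(2) g]) (simp add: mult.assoc)
  moreover have "0 \<le> ?l4" unfolding l4 using l(1) by simp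
  moreover have "?l4 \<le> exit_bound * exp (- \<omega> * (x + (ap i - am i + bb i)))"
    unfolding l4 using exit_bound_ge(2)[of i] by (intro exp_scaled_le[OF l(2)]) auto
  moreover have "?l4 \<le> qrateQ P \<omega> i / qrate P * exp (- \<omega> * (x + (ap i - am i + bb i)))"
    unfolding l4 by (intro exp_scaled_le[OF l(2)]) auto
  moreover have "x + (ap i - am i + bb i) = x + ap i - am i + bb i" by simp
  ultimately show ?thesis
    unfolding loop_body_def dr tilted_state_def mode_bound_def Let_def by (simp only: split: prod.split) simp
qed

text \<open>Ending a cycle contributes \<open>q / q\<^sup>Q\<close>, which settles the outstanding factor and brings the bound
  back to 1.\<close>

lemma tilted_cycle_end:
  assumes l: "0 \<le> l" "l \<le> qrateQ P \<omega> i / qrate P * exp (- \<omega> * x)"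
  shows "tilted_state u (cycle_end P \<omega> u dr i x l)"
proof -
  obtain k v ap am bb where dr: "dr = (k, v, ap, am, bb)" by (cases dr)
  let ?l2 = "l * (totrateQ P \<omega> i / totrate P i) * (qrate P / qrateQ P \<omega> i) *
    (alpha_plus P i / alpha_plusQ P \<omega> i) * exp (- (alpha_plus P i - alpha_plusQ P \<omega> i) * ap i)"
  let ?l3 = "?l2 * (alpha_minus P i / alpha_minusQ P \<omega> i) *
    exp (- (alpha_minus P i - alpha_minusQ P \<omega> i) * am i)"
  have l2: "?l2 = l * (qrate P / qrateQ P \<omega> i * up_factor i) * exp (- \<omega> * ap i)"
    by (simp add: alpha_plusQ_eq up_factor_def mult_ac)
  have "?l3 = l * ((up_factor i * (alpha_minus P i / alpha_minusQ P \<omega> i)) *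
      (qrate P / qrateQ P \<omega> i)) * (exp (- \<omega> * ap i) * exp (\<omega> * am i))"
    unfolding l2 by (simp add: alpha_minusQ_eq mult_ac)
  also have "\<dots> = l * (qrate P / qrateQ P \<omega> i) * exp (- \<omega> * (ap i - am i))"
    unfolding up_factor_down by (simp add: algebra_simps flip: exp_add)
  finally have l3: "?l3 = l * (qrate P / qrateQ P \<omega> i) * exp (- \<omega> * (ap i - am i))" .
  have g: "0 \<le> qrate P / qrateQ P \<omega> i * up_factor i" "0 \<le> qrate P / qrateQ P \<omega> i"
    using qrate_pos qrateQ_pos[of i] up_factor_pos[of i] by simp_all
  have "0 \<le> ?l2" unfolding l2 by (rule mult_nonneg_nonneg[OF mult_nonneg_nonneg[OF l(1) g(1)] exp_ge_zero])
  moreover have "?l2 \<le> exit_bound * exp (- \<omega> * (x + ap i))"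
    unfolding l2 using exit_bound_ge(3)[of i] qrate_pos qrateQ_pos[of i]
    by (intro exp_scaled_le[OF l(2) g(1)]) simp
  moreover have "0 \<le> ?l3" unfolding l3 using l(1) g by (intro mult_nonneg_nonneg) auto
  moreover have "?l3 \<le> 1 * exp (- \<omega> * (x + (ap i - am i)))"
    unfolding l3 using qrate_pos qrateQ_pos[of i] by (intro exp_scaled_le[OF l(2) g(2)]) simp
  moreover have "x + (ap i - am i) = x + ap i - am i" by simp
  ultimately show ?thesis
    unfolding cycle_end_def dr tilted_state_def mode_bound_def Let_def by (simp only: split: prod.split) simp
qed

lemma tilted_loop_test:
  assumes "0 \<le> l" "l \<le> qrateQ P \<omega> i / qrate P * exp (- \<omega> * x)"
  shows "tilted_state u (loop_test P \<omega> u dr i x l)"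
  unfolding loop_test_def
  using tilted_loop_body[OF assms] tilted_cycle_end[OF assms] by (simp split: prod.split)

lemma tilted_round_step:
  assumes "tilted_state u st"
  shows "tilted_state u (round_step P \<omega> u dr st)"
proof -
  obtain md x l where st: "st = (md, x, l)" by (cases st)
  have l: "0 \<le> l" "l \<le> mode_bound md * exp (- \<omega> * x)"
    using assms by (simp_all add: st tilted_state_def)
  show ?thesis
  proof (cases md)
    case NewCycle
    define i where "i = fst dr"
    define c where "c = wgt P i / wgtQ P \<omega> i"
    \<comment> \<open>A regime of weight 0 has \<open>c = 0 / 0 = 0\<close>, hence only an inequality.\<close>
    have c: "0 \<le> c" "c \<le> qrateQ P \<omega> i / qrate P"
      using qrate_pos qrateQ_pos[of i] by (auto simp: c_def wgtQ_def qrateQ_def)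
    have "l * c \<le> exp (- \<omega> * x) * (qrateQ P \<omega> i / qrate P)"
      using l c NewCycle by (intro mult_mono) (auto simp: mode_bound_def)
    then have "tilted_state u (loop_test P \<omega> u dr i x (l * c))"
      using l c by (intro tilted_loop_test) (simp_all add: mult.commute)
    then show ?thesis
      by (simp add: round_step_def st NewCycle c_def i_def Let_def)
  next
    case (InLoop i)
    then show ?thesis
      using tilted_loop_test[of l i x u dr] l by (simp add: round_step_def st mode_bound_def)
  next
    case Exited
    then show ?thesis using assms by (simp add: round_step_def st)
  qed
qed

lemma tilted_run: "tilted_state u (run P \<omega> u ds n)"
  by (induction n) (simp_all add: tilted_round_step, simp add: tilted_state_def mode_bound_def)

text \<open>The bound is pathwise because no overshoot distribution enters: beyond \<open>u\<close> the factor
  \<open>exp (- \<omega> * X)\<close> only gets smaller. Runs that never exit return 0 and satisfy it trivially.\<close>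

lemma estimate_bounds:
  "0 \<le> estimate P \<omega> u ds" "estimate P \<omega> u ds \<le> exit_bound * exp (- \<omega> * u)"
proof -
  let ?n = "LEAST n. fst (run P \<omega> u ds n) = Exited"
  have "0 \<le> estimate P \<omega> u ds \<and> estimate P \<omega> u ds \<le> exit_bound * exp (- \<omega> * u)"
  proof (cases "\<exists>n. fst (run P \<omega> u ds n) = Exited")
    case True
    then have "fst (run P \<omega> u ds ?n) = Exited" by (rule LeastI_ex)
    then obtain x l where r: "run P \<omega> u ds ?n = (Exited, x, l)"
      by (metis prod.collapse)
    have "0 \<le> l" "l \<le> exit_bound * exp (- \<omega> * x)" "u < x"
      using tilted_run[of u ds ?n] by (simp_all add: r tilted_state_def mode_bound_def)
    moreover have "exit_bound * exp (- \<omega> * x) \<le> exit_bound * exp (- \<omega> * u)"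
      using \<open>u < x\<close> \<omega>_pos exit_bound_nonneg by (intro mult_left_mono) auto
    ultimately show ?thesis
      using True by (simp add: estimate_def r)
  next
    case False
    then show ?thesis by (simp add: estimate_def exit_bound_nonneg)
  qed
  then show "0 \<le> estimate P \<omega> u ds" "estimate P \<omega> u ds \<le> exit_bound * exp (- \<omega> * u)" by auto
qed

end

section \<open>Measurability on the sampling space\<close>

abbreviation state_algebra :: "'i state measure" where
  "state_algebra \<equiv> count_space UNIV \<Otimes>\<^sub>M borel \<Otimes>\<^sub>M borel"

lemma sets_round_measure:
  assumes "\<And>i. sets (FQ i) = sets borel"
  shows "sets (round_measure P \<omega> FQ) = sets (count_space UNIV \<Otimes>\<^sub>M borel \<Otimes>\<^sub>M
    (\<Pi>\<^sub>M i\<in>UNIV. borel) \<Otimes>\<^sub>M (\<Pi>\<^sub>M i\<in>UNIV. borel) \<Otimes>\<^sub>M (\<Pi>\<^sub>M i\<in>UNIV. borel))"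
  unfolding round_measure_def
  by (intro sets_pair_measure_cong sets_PiM_cong) (simp_all add: assms)

lemma measurable_loop_test:
  fixes P :: "('i::finite) risk_params"
  assumes "\<And>i. sets (FQ i) = sets borel"
  shows "(\<lambda>(dr, x, l). loop_test P \<omega> u dr i x l)
    \<in> measurable (round_measure P \<omega> FQ \<Otimes>\<^sub>M borel \<Otimes>\<^sub>M borel) state_algebra"
proof -
  note [measurable_cong] = sets_round_measure[OF assms]
  show ?thesis
    unfolding loop_test_def loop_body_def cycle_end_def Let_def case_prod_beta
    by measurable
qed

text \<open>The step is a case distinction over finitely many modes and regimes. Once both are fixed, the
  update is an explicit function of the draws, the position and the likelihood ratio.\<close>

lemma measurable_round_step:
  fixes P :: "('i::finite) risk_params"
  assumes FQ: "\<And>i. sets (FQ i) = sets borel"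
  shows "(\<lambda>(dr, st). round_step P \<omega> u dr st)
    \<in> measurable (round_measure P \<omega> FQ \<Otimes>\<^sub>M state_algebra) state_algebra"
proof -
  note [measurable_cong] = sets_round_measure[OF FQ]
  let ?N = "round_measure P \<omega> FQ \<Otimes>\<^sub>M state_algebra :: ('i draws \<times> 'i state) measure"
  have lt: "(\<lambda>w. loop_test P \<omega> u (fst w) i (fst (snd (snd w))) (h w)) \<in> measurable ?N state_algebra"
    if [measurable]: "h \<in> borel_measurable ?N" for i h
    using measurable_compose[OF _ measurable_loop_test[where FQ = FQ and P = P and \<omega> = \<omega> and u = u and i = i],
        where f = "\<lambda>w. (fst w, fst (snd (snd w)), h w)" and M = ?N] FQ
    by simp
  have "countable (UNIV :: 'i mode set)"
  proof -
    have "md \<in> insert NewCycle (insert Exited (range InLoop))" for md :: "'i mode"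
      by (cases md) auto
    then have "UNIV = insert NewCycle (insert Exited (range (InLoop :: 'i \<Rightarrow> _)))" by blast
    then show ?thesis by (metis countable_finite finite finite_imageI finite_insert)
  qed
  then have "(\<lambda>w. round_step P \<omega> u (fst w) (fst (snd w), snd (snd w))) \<in> measurable ?N state_algebra"
  proof (rule measurable_compose_countable'[rotated 2, where g = "\<lambda>w. fst (snd w)"])
    show "(\<lambda>w. fst (snd w)) \<in> measurable ?N (count_space UNIV)" by measurable
    fix md :: "'i mode"
    show "(\<lambda>w. round_step P \<omega> u (fst w) (md, snd (snd w))) \<in> measurable ?N state_algebra"
    proof (cases md)
      case NewCycle
      have "(\<lambda>w. loop_test P \<omega> u (fst w) (fst (fst w)) (fst (snd (snd w)))
          (snd (snd (snd w)) * (wgt P (fst (fst w)) / wgtQ P \<omega> (fst (fst w))))) \<in> measurable ?N state_algebra"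
        by (rule measurable_compose_countable[where g = "\<lambda>w. fst (fst w)"], rule lt) measurable
      then show ?thesis by (simp add: round_step_def NewCycle case_prod_beta Let_def)
    next
      case (InLoop i)
      have "(\<lambda>w. loop_test P \<omega> u (fst w) i (fst (snd (snd w))) (snd (snd (snd w)))) \<in> measurable ?N state_algebra"
        by (rule lt) measurable
      then show ?thesis by (simp add: round_step_def InLoop case_prod_beta)
    next
      case Exited
      then show ?thesis by (simp add: round_step_def case_prod_beta)
    qed
  qed
  then show ?thesis by (simp add: case_prod_beta)
qed

lemma measurable_run:
  fixes P :: "('i::finite) risk_params"
  assumes FQ: "\<And>i. sets (FQ i) = sets borel"
  shows "(\<lambda>ds. run P \<omega> u ds n) \<in> measurable (sampling_measure P \<omega> FQ) state_algebra"
proof (induction n)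
  case 0
  show ?case by (simp add: space_pair_measure)
next
  case (Suc n)
  have "(\<lambda>ds. (ds n, run P \<omega> u ds n))
      \<in> measurable (sampling_measure P \<omega> FQ) (round_measure P \<omega> FQ \<Otimes>\<^sub>M state_algebra)"
    using Suc unfolding sampling_measure_def by measurable
  from measurable_compose[OF this measurable_round_step[OF FQ]] show ?case by simp
qed

lemma measurable_estimate:
  fixes P :: "('i::finite) risk_params"
  assumes FQ: "\<And>i. sets (FQ i) = sets borel"
  shows "estimate P \<omega> u \<in> borel_measurable (sampling_measure P \<omega> FQ)"
proof -
  note [measurable] = measurable_run[OF FQ, of P \<omega> u]
  have [measurable]: "Measurable.pred (sampling_measure P \<omega> FQ) (\<lambda>ds. fst (run P \<omega> u ds n) = Exited)" for n
    by measurable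
  have [measurable]: "(\<lambda>ds. snd (snd (run P \<omega> u ds (LEAST n. fst (run P \<omega> u ds n) = Exited))))
      \<in> borel_measurable (sampling_measure P \<omega> FQ)"
    by (rule measurable_compose_countable[where g = "\<lambda>ds. LEAST n. fst (run P \<omega> u ds n) = Exited"]) measurable
  show ?thesis
    unfolding estimate_def[abs_def] by measurable
qed

lemma (in tilted_parameters) prob_space_sampling_measure:
  assumes "\<And>i. prob_space (FQ i)"
  shows "prob_space (sampling_measure P \<omega> FQ)"
  unfolding sampling_measure_def round_measure_def
  by (intro prob_space_PiM prob_space_pair prob_space_measure_pmf assms
      prob_space_uniform_measure prob_space_exponential_density alpha_pos) auto

section \<open>Bounded relative error\<close>

lemma (in prob_space) variance_le_bound_square:
  fixes Z :: "'a \<Rightarrow> real"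
  assumes Z: "Z \<in> borel_measurable M" and b: "\<And>w. 0 \<le> Z w" "\<And>w. Z w \<le> B"
  shows "integrable M (\<lambda>w. (Z w)\<^sup>2)" "variance Z \<le> B\<^sup>2"
proof -
  have sq: "(Z w)\<^sup>2 \<le> B\<^sup>2" for w using b by (intro power_mono)
  show int: "integrable M (\<lambda>w. (Z w)\<^sup>2)"
    using Z sq by (intro integrable_const_bound[where B = "B\<^sup>2"]) auto
  moreover have "integrable M Z"
    using Z b by (intro integrable_const_bound[where B = B]) auto
  ultimately have "variance Z = expectation (\<lambda>w. (Z w)\<^sup>2) - (expectation Z)\<^sup>2"
    by (intro variance_eq)
  also have "\<dots> \<le> expectation (\<lambda>w. (Z w)\<^sup>2)" by simp
  also have "\<dots> \<le> B\<^sup>2"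
    using integral_mono[OF int integrable_const sq] by (simp add: prob_space)
  finally show "variance Z \<le> B\<^sup>2" .
qed

theorem theorem3:
  fixes M :: "'w measure"
    and P :: "('i::finite) risk_params"
    and X :: "'i \<Rightarrow> real \<Rightarrow> 'w \<Rightarrow> real"
    and T :: "nat \<Rightarrow> 'w \<Rightarrow> real"
    and J :: "nat \<Rightarrow> 'w \<Rightarrow> 'i"
    and FQ :: "'i \<Rightarrow> real measure"
    and \<omega> A :: real
  assumes model: "resampled_model M P X T J"
    and negative_drift: "(\<Sum>i\<in>UNIV. wgt P i * deriv (phi P i) 0) > 0"
    and light_tails: "\<forall>i. \<exists>\<epsilon>>0. \<forall>\<alpha>. \<bar>\<alpha>\<bar> < \<epsilon> \<longrightarrow> claim_lt P i \<alpha> < \<infinity>"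
    and root_pos: "\<omega> > 0"
    and root_finite: "\<forall>i. claim_lt P i (- \<omega>) < \<infinity> \<and> phi P i (- \<omega>) < qrate P"
    and root: "laplace_transform M (\<lambda>w. resampled X T J (T 1 w) w) (- \<omega>) = 1"
    and root_sum: "(\<Sum>i\<in>UNIV. wgt P i * (qrate P / (qrate P - phi P i (- \<omega>)))) = 1"
    and claimsQ: "\<forall>i. real_distribution (FQ i) \<and>
      (\<forall>\<alpha>. laplace_transform (FQ i) (\<lambda>x. x) \<alpha> = claim_ltQ P \<omega> i \<alpha>)"
    and asymp: "((\<lambda>u. ruin_prob M X T J u * exp (\<omega> * u)) \<longlongrightarrow> A) at_top"
    and A_pos: "A > 0"
  shows "(\<forall>\<^sub>F u in at_top.
            integrable (sampling_measure P \<omega> FQ) (\<lambda>ds. (estimate P \<omega> u ds)\<^sup>2)) \<and>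
         Limsup at_top (\<lambda>u. ereal
            (prob_space.variance (sampling_measure P \<omega> FQ) (estimate P \<omega> u)
              / (ruin_prob M X T J u)\<^sup>2)) < \<infinity>"
proof -
  have laplace_pos: "claim_lt P i (- \<omega>) \<noteq> 0" for i
  proof -
    interpret real_distribution "claim P i" using model by (simp add: resampled_model_def)
    show ?thesis
      unfolding claim_lt_def laplace_transform_def by (subst nn_integral_0_iff_AE) auto
  qed
  interpret tilted_parameters P \<omega>
  proof
    show "bfun P i (- \<omega>) > 0" for i
      using laplace_pos[of i] root_finite by (auto simp: enn2real_positive_iff zero_less_iff_neq_zero)
  qed (use model root_pos root_finite in \<open>auto simp: resampled_model_def\<close>)
  have FQ: "sets (FQ i) = sets borel" "prob_space (FQ i)" for i
    using claimsQ by (auto simp: real_distribution_def real_distribution_axioms_def)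
  interpret S: prob_space "sampling_measure P \<omega> FQ"
    by (rule prob_space_sampling_measure[OF FQ(2)])
  note bound = S.variance_le_bound_square[OF measurable_estimate[OF FQ(1)] estimate_bounds]
  have "\<forall>\<^sub>F u in at_top. A / 2 < ruin_prob M X T J u * exp (\<omega> * u)"
    using A_pos by (intro order_tendstoD[OF asymp]) simp
  then have "\<forall>\<^sub>F u in at_top.
      ereal (S.variance (estimate P \<omega> u) / (ruin_prob M X T J u)\<^sup>2) \<le> ereal ((2 * exit_bound / A)\<^sup>2)"
  proof eventually_elim
    case (elim u)
    define p where "p = ruin_prob M X T J u"
    have e: "A / 2 * exp (- \<omega> * u) < p"
      using elim by (simp add: p_def exp_minus field_simps)
    have pos: "0 < A / 2 * exp (- \<omega> * u)" using A_pos by simp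
    have "S.variance (estimate P \<omega> u) / p\<^sup>2 \<le> (exit_bound * exp (- \<omega> * u))\<^sup>2 / (A / 2 * exp (- \<omega> * u))\<^sup>2"
      using bound(2)[of u] e pos
      by (intro frac_le power_mono) auto
    also have "\<dots> = (2 * exit_bound / A)\<^sup>2"
      by (simp add: power_divide power_mult_distrib)
    finally show ?case by (simp add: p_def)
  qed
  from Limsup_bounded[OF this] have
    "Limsup at_top (\<lambda>u. ereal (S.variance (estimate P \<omega> u) / (ruin_prob M X T J u)\<^sup>2)) < \<infinity>"
    using less_ereal.simps(4) order.strict_trans1 by blast
  then show ?thesis using bound(1) by simp
qed

end
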